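(* Let $k$ be an even integer greater than $2$ and $n$ an odd integer greater than $k$. Let $G=(\mathbb{Z}_n;\{1,2,\dots,k-1\})$ be the hypergraph with vertex set $\mathbb{Z}_n$ and edges $\{i,i+1,\dots,i+k-1\}$ (indices mod $n$) for $i\in\mathbb{Z}_n$. Then $G$ is minimal non-odd-bipartite if and only if $\gcd(k,n)=1$.
   Context: For $k$ even, a $k$-uniform hypergraph $G$ (every edge has $k$ vertices, no multiple edges) is odd-bipartite if there is a bipartition $\{U,U^c\}$ of $V(G)$ such that every edge meets $U$ (and hence $U^c$) in an odd number of vertices. It is minimal non-odd-bipartite if it is not odd-bipartite but $G-e$ (delete the edge $e$ from the edge set) is odd-bipartite for every edge $e$. *)

theory Defs
  imports Main
begin

record 'a hypergraph =
  verts :: "'a set"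
  edges :: "'a set set"

definition uniform_hypergraph :: "nat \<Rightarrow> 'a hypergraph \<Rightarrow> bool" where
  "uniform_hypergraph k G \<longleftrightarrow>
     finite (verts G) \<and> (\<forall>e \<in> edges G. e \<subseteq> verts G \<and> card e = k)"

text \<open>Meaningful for uniform hypergraphs of even rank. There an edge that meets \<open>U\<close> in an odd
  number of vertices also meets the complement of \<open>U\<close> in an odd number of vertices, so both parts
  are automatically nonempty as soon as there is an edge.\<close>

definition odd_bipartite :: "'a hypergraph \<Rightarrow> bool" where
  "odd_bipartite G \<longleftrightarrow> (\<exists>U \<subseteq> verts G. \<forall>e \<in> edges G. odd (card (e \<inter> U)))"

definition delete_edge :: "'a hypergraph \<Rightarrow> 'a set \<Rightarrow> 'a hypergraph" where
  "delete_edge G e = G\<lparr>edges := edges G - {e}\<rparr>"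

definition minimal_non_odd_bipartite :: "'a hypergraph \<Rightarrow> bool" where
  "minimal_non_odd_bipartite G \<longleftrightarrow>
     \<not> odd_bipartite G \<and> (\<forall>e \<in> edges G. odd_bipartite (delete_edge G e))"

text \<open>The residues modulo \<open>n\<close> are represented by \<open>0, \<dots>, n - 1\<close>; the edges are the sets
  of \<open>k\<close> cyclically consecutive residues.\<close>

definition cyclic_hypergraph :: "nat \<Rightarrow> nat \<Rightarrow> nat hypergraph" where
  "cyclic_hypergraph n k =
     \<lparr>verts = {0..<n}, edges = {(\<lambda>j. (i + j) mod n) ` {0..k - 1} | i. i \<in> {0..<n}}\<rparr>"

lemma uniform_cyclic_hypergraph:
  assumes "0 < k" and "k \<le> n"
  shows "uniform_hypergraph k (cyclic_hypergraph n k)"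
proof -
  have "inj_on (\<lambda>j. (i + j) mod n) {0..k - 1}" for i
  proof (rule linorder_inj_onI')
    fix a b assume ab: "a \<in> {0..k - 1}" "b \<in> {0..k - 1}" "a < b"
    show "(i + a) mod n \<noteq> (i + b) mod n"
    proof
      assume "(i + a) mod n = (i + b) mod n"
      then have "n dvd (i + b) - (i + a)"
        using ab by (metis mod_eq_dvd_iff_nat add_le_cancel_left less_imp_le)
      then have "n \<le> b - a" using ab by (auto dest: dvd_imp_le)
      then show False using ab assms by auto
    qed
  qed
  then show ?thesis
    using assms by (auto simp: uniform_hypergraph_def cyclic_hypergraph_def card_image)
qed

end

theory Submission
  imports Defs "HOL-Number_Theory.Cong"
begin

text \<open>Let \<open>d\<close> be a common divisor of \<open>k\<close> and \<open>n\<close>; it is odd. A vertex lies in exactly \<open>k / d\<close> of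
  the edges whose first vertex is in a given residue class modulo \<open>d\<close>. This number is even, while
  the number \<open>n / d\<close> of such edges is odd, so these edges cannot all meet \<open>U\<close> oddly. With \<open>d = 1\<close>
  this shows that the hypergraph is never odd-bipartite; with \<open>d = gcd k n > 1\<close> it survives the
  deletion of an edge from another residue class.

  If \<open>gcd k n = 1\<close>, choose \<open>m\<close> with \<open>k m \<equiv> -1\<close> modulo \<open>n\<close> and let
  \<open>U = {s + k, s + 2k, \<dots>, s + m k = s - 1}\<close>. The edges starting at \<open>i\<close> and \<open>i + 1\<close> meet \<open>U\<close> in
  the same number of vertices unless membership in \<open>U\<close> changes from \<open>i\<close> to \<open>i + k\<close>, that is, unless
  \<open>i\<close> is \<open>s\<close> or \<open>s - 1\<close>. Hence only the parity of the edge starting at \<open>s\<close> differs from the others,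
  and the counting argument identifies it as the even one.\<close>

definition cyclic_edge :: "nat \<Rightarrow> nat \<Rightarrow> nat \<Rightarrow> nat set" where
  "cyclic_edge n k i = (\<lambda>j. (i + j) mod n) ` {..<k}"

lemma edges_cyclic_hypergraph:
  assumes "0 < k"
  shows "edges (cyclic_hypergraph n k) = cyclic_edge n k ` {..<n}"
proof -
  have "{0..k - 1} = {..<k}" using assms by auto
  then show ?thesis by (auto simp: cyclic_hypergraph_def cyclic_edge_def)
qed

lemma verts_cyclic_hypergraph: "verts (cyclic_hypergraph n k) = {..<n}"
  by (auto simp: cyclic_hypergraph_def)

lemma inj_on_add_mod:
  fixes i k n :: nat
  assumes "k \<le> n"
  shows "inj_on (\<lambda>j. (i + j) mod n) {..<k}"
proof (rule inj_onI)
  fix a b assume "a \<in> {..<k}" "b \<in> {..<k}" "(i + a) mod n = (i + b) mod n"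
  then have "[a = b] (mod n)" "a < n" "b < n"
    using assms by (auto simp: cong_def[symmetric] cong_add_lcancel_nat)
  then show "a = b" by (simp add: cong_def)
qed

text \<open>As \<open>k \<le> n\<close>, no residue repeats along an edge, so intersection sizes
  become window sums of a periodic 0/1 function on the naturals.\<close>

lemma card_cyclic_edge_Int:
  assumes "k \<le> n"
  shows "card (cyclic_edge n k i \<inter> U) = (\<Sum>j<k. of_bool ((i + j) mod n \<in> U))"
proof -
  have "cyclic_edge n k i \<inter> U = (\<lambda>j. (i + j) mod n) ` {j \<in> {..<k}. (i + j) mod n \<in> U}"
    by (auto simp: cyclic_edge_def)
  also have "card \<dots> = card {j \<in> {..<k}. (i + j) mod n \<in> U}"
    by (rule card_image, rule inj_on_subset[OF inj_on_add_mod[OF assms]]) auto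
  also have "\<dots> = (\<Sum>j<k. of_bool ((i + j) mod n \<in> U))"
    by (simp add: Int_def)
  finally show ?thesis .
qed

text \<open>Otherwise \<open>i - 1\<close> would lie in the edge starting at \<open>i\<close>, but
  reaching it takes \<open>n - 1\<close> steps and \<open>k < n\<close>. Edges are deleted as sets,
  so this coincidence has to be excluded.\<close>

lemma cyclic_edge_neq_cyclic_edge_0:
  assumes "0 < k" "k < n" "0 < i" "i < n"
  shows "cyclic_edge n k i \<noteq> cyclic_edge n k 0"
proof
  assume eq: "cyclic_edge n k i = cyclic_edge n k 0"
  have e0: "cyclic_edge n k 0 = {..<k}"
    using assms by (force simp: cyclic_edge_def)
  have "i \<in> cyclic_edge n k i"
    using assms by (auto simp: cyclic_edge_def intro!: image_eqI[of _ _ 0])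
  then have "i - 1 \<in> cyclic_edge n k i" using eq e0 by auto
  then obtain j where j: "j < k" "(i + j) mod n = i - 1" by (auto simp: cyclic_edge_def)
  then have "[(i - 1) + (j + 1) = (i - 1) + 0] (mod n)"
    using assms by (simp add: cong_def)
  then have "[j + 1 = 0] (mod n)" by (simp only: cong_add_lcancel_nat)
  then show False using j assms by (simp add: cong_def)
qed

lemma sum_lessThan_periodic:
  fixes h :: "nat \<Rightarrow> nat"
  assumes "\<And>x. h (x + d) = h x"
  shows "(\<Sum>j<q * d. h j) = q * (\<Sum>j<d. h j)"
proof -
  have "(\<Sum>j<q * d. h j) = (\<Sum>a<q. sum h {a * d..<a * d + d})"
    by (rule sum.nat_group[symmetric])
  also have "\<dots> = (\<Sum>a<q. \<Sum>j<d. h j)"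
  proof (rule sum.cong[OF refl])
    fix a
    have "h (x + a * d) = h x" for x
    proof (induction a)
      case (Suc a)
      then show ?case using assms[of "x + a * d"] by (simp add: ac_simps)
    qed simp
    then show "sum h {a * d..<a * d + d} = (\<Sum>j<d. h j)"
      using sum.shift_bounds_nat_ivl[of h 0 "a * d" d]
      by (simp add: add.commute atLeast0LessThan)
  qed
  finally show ?thesis by simp
qed

text \<open>After swapping the sums, the inner sum \<open>T\<close> has period \<open>d\<close>: a
  shift by \<open>d\<close> only replaces its first term by the one \<open>n\<close> further on. The
  window consists of \<open>k div d\<close> periods, an even number because \<open>d\<close> divides
  the odd \<open>n\<close>.\<close>

lemma even_sum_window_sums:
  fixes g :: "nat \<Rightarrow> nat"
  assumes per: "\<And>x. g (x + n) = g x" and "even k" "odd n" "d dvd k" "d dvd n"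
  shows "even (\<Sum>a<n div d. \<Sum>j<k. g (r + a * d + j))"
proof -
  define T where "T x = (\<Sum>a<n div d. g (r + a * d + x))" for x
  have n: "n div d * d = n" and k: "k div d * d = k" using assms by auto
  have "T (x + d) = T x" for x
  proof -
    have "T (x + d) = (\<Sum>a<n div d. g (r + Suc a * d + x))"
      by (simp add: T_def add_ac)
    moreover have "(\<Sum>a<n div d. g (r + Suc a * d + x)) + g (r + 0 * d + x)
        = T x + g (r + n div d * d + x)"
      unfolding T_def using sum.lessThan_Suc_shift[of "\<lambda>a. g (r + a * d + x)" "n div d"]
      by (simp add: add.commute)
    moreover have "g (r + n div d * d + x) = g (r + 0 * d + x)"
      using per[of "r + x"] n by (simp add: add_ac)
    ultimately show ?thesis by simp
  qed
  then have "(\<Sum>j<k. T j) = k div d * (\<Sum>j<d. T j)"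
    using sum_lessThan_periodic[of T d "k div d"] k by simp
  moreover have "odd d" using \<open>odd n\<close> dvd_trans[OF _ \<open>d dvd n\<close>] by blast
  then have "even (k div d)" using \<open>even k\<close> k even_mult_iff[of "k div d" d] by simp
  moreover have "(\<Sum>a<n div d. \<Sum>j<k. g (r + a * d + j)) = (\<Sum>j<k. T j)"
    unfolding T_def by (rule sum.swap)
  ultimately show ?thesis by simp
qed

text \<open>Otherwise an odd number \<open>n div d\<close> of odd cardinalities would have an even
  sum.\<close>

lemma exists_even_cyclic_edge:
  assumes "even k" "odd n" "k \<le> n" "d dvd k" "d dvd n" "r < d"
  shows "\<exists>i<n. i mod d = r \<and> even (card (cyclic_edge n k i \<inter> U))"
proof (rule ccontr)
  assume *: "\<not> ?thesis"
  have n: "n div d * d = n" using assms by auto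
  have "odd (card (cyclic_edge n k (r + a * d) \<inter> U))" if "a < n div d" for a
  proof -
    have "Suc a * d \<le> n div d * d" using that by (intro mult_right_mono) auto
    then have "r + a * d < n" using n \<open>r < d\<close> by simp
    then show ?thesis using * \<open>r < d\<close> by auto
  qed
  then have "{a \<in> {..<n div d}. odd (card (cyclic_edge n k (r + a * d) \<inter> U))} = {..<n div d}"
    by auto
  then have "even (\<Sum>a<n div d. card (cyclic_edge n k (r + a * d) \<inter> U)) = even (n div d)"
    by (subst even_sum_iff) simp_all
  moreover have "odd (n div d)" using n \<open>odd n\<close> even_mult_iff[of "n div d" d] by simp
  moreover have "even (\<Sum>a<n div d. card (cyclic_edge n k (r + a * d) \<inter> U))"
    using even_sum_window_sums[of "\<lambda>x. of_bool (x mod n \<in> U)" n k d r] assms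
    by (simp add: card_cyclic_edge_Int)
  ultimately show False by simp
qed

lemma window_sum_Suc:
  fixes g :: "nat \<Rightarrow> nat"
  shows "(\<Sum>j<k. g (Suc i + j)) + g i = (\<Sum>j<k. g (i + j)) + g (i + k)"
  using sum.lessThan_Suc_shift[of "\<lambda>j. g (i + j)" k] by simp

text \<open>The set serves as bipartition once the edge starting at \<open>s\<close> is
  deleted.\<close>

lemma exists_only_even_cyclic_edge:
  assumes "even k" "k > 0" "odd n" "n > k" "coprime k n" "s < n"
  shows "\<exists>U\<subseteq>{..<n}. \<forall>i<n. i \<noteq> s \<longrightarrow> odd (card (cyclic_edge n k i \<inter> U))"
proof -
  have n1: "n > 1" using assms by auto
  obtain m' where m': "[int k * m' = 1] (mod int n)"
    using \<open>coprime k n\<close> cong_solve_coprime_int[of "int k" "int n"] by auto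
  \<comment> \<open>The residue is taken in \<open>{0..<n}\<close> so that membership in the
    progression becomes the interval condition \<open>1 \<le> t \<le> m\<close>.\<close>
  define m where "m = (- m') mod int n"
  have km: "[int k * m = - 1] (mod int n)"
  proof -
    have "[int k * m = int k * (- m')] (mod int n)"
      unfolding m_def by (intro cong_mult) auto
    also have "[int k * (- m') = - 1] (mod int n)"
      using m' by (simp add: cong_minus_minus_iff)
    finally show ?thesis .
  qed
  have "coprime (- 1) (int n)" by simp
  then have "coprime (int k * m) (int n)" using cong_imp_coprime[OF cong_sym[OF km]] by simp
  then have cop: "coprime m (int n)" by simp
  have m: "0 \<le> m" "m < int n" using n1 by (auto simp: m_def)
  have "m \<noteq> 0" using cop n1 by auto
  then have m1: "m \<ge> 1" using m by simp
  \<comment> \<open>\<open>\<tau> x\<close> is the residue \<open>t\<close> with \<open>x \<equiv> s + k t\<close>.\<close>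
  define \<tau> where "\<tau> x = (m * (int s - int x)) mod int n" for x
  \<comment> \<open>The indicator of the progression, as a function on all naturals.\<close>
  define g :: "nat \<Rightarrow> nat" where "g x = of_bool (1 \<le> \<tau> x \<and> \<tau> x \<le> m)" for x
  have \<tau>_range: "0 \<le> \<tau> x" "\<tau> x < int n" for x using n1 by (auto simp: \<tau>_def)
  have \<tau>_mod: "\<tau> (x mod n) = \<tau> x" for x
    unfolding \<tau>_def cong_def[symmetric] zmod_int by (intro cong_mult cong_diff) auto
  have \<tau>_add: "\<tau> (x + k) = (\<tau> x + 1) mod int n" for x
  proof -
    have "[m * (int s - int x) - int k * m = m * (int s - int x) - (- 1)] (mod int n)"
      using km by (intro cong_diff) auto
    then show ?thesis by (simp add: \<tau>_def cong_def algebra_simps mod_simps)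
  qed
  have \<tau>_0: "[int x = int s] (mod int n)" if "\<tau> x = 0" for x
  proof -
    have "int n dvd m * (int s - int x)" using that by (simp add: \<tau>_def mod_eq_0_iff_dvd)
    then have "int n dvd int s - int x"
      using cop by (simp add: coprime_dvd_mult_right_iff coprime_commute)
    then show ?thesis using cong_iff_dvd_diff cong_sym by blast
  qed
  have \<tau>_m: "[int x + 1 = int s] (mod int n)" if "\<tau> x = m" for x
  proof -
    have "[m * (int s - int x) = m * 1] (mod int n)" using that m by (simp add: \<tau>_def cong_def)
    then have "[int s - int x = 1] (mod int n)" using cop cong_mult_lcancel by blast
    then have "[int s - int x + int x = 1 + int x] (mod int n)" by (intro cong_add) auto
    then show ?thesis by (simp add: cong_sym add.commute)
  qed
  \<comment> \<open>Adding \<open>k\<close> raises \<open>t\<close> by one modulo \<open>n\<close>,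
    so membership changes only on entering from \<open>t = 0\<close> and on leaving at
    \<open>t = m\<close>.\<close>
  have g_add: "g (x + k) = g x" if "\<tau> x \<noteq> 0" "\<tau> x \<noteq> m" for x
  proof (cases "\<tau> x + 1 = int n")
    \<comment> \<open>Here \<open>t\<close> wraps from \<open>n - 1\<close> to \<open>0\<close>;
      both lie outside the interval, since \<open>m \<le> n - 1\<close> and
      \<open>t \<noteq> m\<close>.\<close>
    case True
    then show ?thesis using that m m1 by (auto simp: g_def \<tau>_add)
  next
    case False
    then have "\<tau> (x + k) = \<tau> x + 1" using \<tau>_range[of x] by (simp add: \<tau>_add)
    then show ?thesis using that \<tau>_range[of x] by (auto simp: g_def)
  qed
  have per: "g (x + n) = g x" for x
    using \<tau>_mod[of "x + n"] \<tau>_mod[of x] by (simp add: g_def)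
  define S where "S i = (\<Sum>j<k. g (i + j))" for i
  have S_Suc: "S (Suc i) + g i = S i + g (i + k)" for i
    unfolding S_def by (rule window_sum_Suc)
  have "g s = 0" "g (s + k) = 1"
    using n1 m1 \<tau>_add[of s] by (auto simp: g_def \<tau>_def)
  then have S1: "S (s + 1) = S s + 1" using S_Suc[of s] by simp
  \<comment> \<open>Moving the start from \<open>s + 1\<close> up to \<open>s + n - 1\<close> never
    passes a residue \<open>s\<close> or \<open>s - 1\<close> at which membership changes.\<close>
  have const: "S (s + Suc a) = S (s + 1)" if "Suc a < n" for a
    using that
  proof (induction a)
    case (Suc a)
    have "\<not> [int (s + Suc a) = int s] (mod int n)" "\<not> [int (s + Suc a) + 1 = int s] (mod int n)"
    proof -
      have "\<not> int n dvd int (Suc a)" "\<not> int n dvd int (Suc (Suc a))"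
        using Suc.prems by (auto simp del: of_nat_Suc dest: dvd_imp_le)
      then show "\<not> [int (s + Suc a) = int s] (mod int n)"
        "\<not> [int (s + Suc a) + 1 = int s] (mod int n)"
        by (simp_all add: cong_iff_dvd_diff algebra_simps)
    qed
    then have "g (s + Suc a + k) = g (s + Suc a)" using g_add \<tau>_0 \<tau>_m by blast
    then show ?case using S_Suc[of "s + Suc a"] Suc by simp
  qed simp
  have "(\<Sum>a<n. S (s + a)) = S s + (n - 1) * S (s + 1)"
  proof -
    have "(\<Sum>a<Suc (n - 1). S (s + a)) = S s + (\<Sum>a<n - 1. S (s + Suc a))"
      by (simp only: sum.lessThan_Suc_shift) simp
    also have "(\<Sum>a<n - 1. S (s + Suc a)) = (\<Sum>a<n - 1. S (s + 1))"
      by (intro sum.cong refl const) auto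
    finally show ?thesis using n1 by simp
  qed
  \<comment> \<open>With \<open>d = 1\<close> all \<open>n\<close> edges are counted; as
    \<open>n - 1\<close> is even, only the parity of \<open>S s\<close> remains.\<close>
  moreover have "even (\<Sum>a<n. S (s + a))"
    unfolding S_def using even_sum_window_sums[of g n k 1 s] per assms by simp
  ultimately have "even (S s)" using \<open>odd n\<close> by simp
  then have S_odd: "odd (S (s + Suc a))" if "Suc a < n" for a
    using const[OF that] S1 by simp
  define U where "U = {x \<in> {..<n}. g x = 1}"
  have card_eq: "card (cyclic_edge n k i \<inter> U) = S i" for i
  proof -
    have "of_bool (x mod n \<in> U) = g x" for x
      using n1 \<tau>_mod[of x] by (simp add: U_def g_def)
    then show ?thesis using \<open>n > k\<close> by (simp add: card_cyclic_edge_Int S_def)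
  qed
  have S_per: "S (i + n) = S i" for i
    unfolding S_def
  proof (rule sum.cong[OF refl])
    fix j
    show "g (i + n + j) = g (i + j)" using per[of "i + j"] by (simp add: ac_simps)
  qed
  have "odd (S i)" if "i < n" "i \<noteq> s" for i
  proof (cases "s < i")
    case True
    then show ?thesis using S_odd[of "i - s - 1"] that by simp
  next
    case False
    \<comment> \<open>A start before \<open>s\<close> is reached from \<open>s\<close> by wrapping
      around, as \<open>i + n\<close>.\<close>
    then show ?thesis using S_odd[of "i + n - s - 1"] that S_per[of i] \<open>s < n\<close> by simp
  qed
  then show ?thesis using card_eq by (intro exI[of _ U]) (auto simp: U_def)
qed

theorem theorem4p8:
  fixes k n :: nat
  assumes "even k" and "k > 2" and "odd n" and "n > k"
  shows "minimal_non_odd_bipartite (cyclic_hypergraph n k) \<longleftrightarrow> gcd k n = 1"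
proof
  assume min: "minimal_non_odd_bipartite (cyclic_hypergraph n k)"
  show "gcd k n = 1"
  proof (rule ccontr)
    assume "gcd k n \<noteq> 1"
    moreover have "gcd k n \<noteq> 0" using assms by simp
    ultimately have d: "1 < gcd k n" by linarith
    have "odd_bipartite (delete_edge (cyclic_hypergraph n k) (cyclic_edge n k 0))"
      using min assms by (auto simp: minimal_non_odd_bipartite_def edges_cyclic_hypergraph)
    then obtain U where U: "\<And>i. i < n \<Longrightarrow> cyclic_edge n k i \<noteq> cyclic_edge n k 0 \<Longrightarrow>
        odd (card (cyclic_edge n k i \<inter> U))"
      using assms by (auto simp: odd_bipartite_def delete_edge_def edges_cyclic_hypergraph)
    \<comment> \<open>The deleted edge starts in class \<open>0\<close> modulo the gcd, so class
      \<open>1\<close> is untouched and still forces an even edge.\<close>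
    obtain i where i: "i < n" "i mod gcd k n = 1" "even (card (cyclic_edge n k i \<inter> U))"
      using exists_even_cyclic_edge[of k n "gcd k n" 1 U] d assms by auto
    then have "0 < i" by (cases i) auto
    then show False using cyclic_edge_neq_cyclic_edge_0[of k n i] U[of i] i assms by simp
  qed
next
  assume gcd: "gcd k n = 1"
  have "\<not> odd_bipartite (cyclic_hypergraph n k)"
  proof
    assume "odd_bipartite (cyclic_hypergraph n k)"
    then obtain U where "\<And>i. i < n \<Longrightarrow> odd (card (cyclic_edge n k i \<inter> U))"
      using assms by (auto simp: odd_bipartite_def edges_cyclic_hypergraph)
    then show False using exists_even_cyclic_edge[of k n 1 0 U] assms by auto
  qed
  moreover have "odd_bipartite (delete_edge (cyclic_hypergraph n k) (cyclic_edge n k s))"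
    if s: "s < n" for s
  proof -
    have "coprime k n" using gcd by (simp only: coprime_iff_gcd_eq_1)
    moreover have "0 < k" using assms by simp
    ultimately obtain U where "U \<subseteq> {..<n}"
        "\<forall>i<n. i \<noteq> s \<longrightarrow> odd (card (cyclic_edge n k i \<inter> U))"
      using exists_only_even_cyclic_edge[of k n s] s assms by blast
    then show ?thesis
      using assms unfolding odd_bipartite_def delete_edge_def
      by (intro exI[of _ U]) (auto simp: edges_cyclic_hypergraph verts_cyclic_hypergraph)
  qed
  ultimately show "minimal_non_odd_bipartite (cyclic_hypergraph n k)"
    using assms by (auto simp: minimal_non_odd_bipartite_def edges_cyclic_hypergraph)
qed

end
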